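(* Let $\mathcal A=\langle Q,\Sigma,\Delta,\mathcal R\rangle$ be a TA whose language consists of $n$-qubit trees. Let $U$ be one of $\mathrm{CNOT}^c_t$ or $\mathrm{CZ}^c_t$ with $1\le c<t\le n$, or $\mathrm{Toffoli}^{c,c'}_t$ with $1\le c<c'<t\le n$. Define $\mathcal A_1=\langle Q_1,\Sigma_1,\Delta_1,\mathcal R\rangle$ to be $X_t(\mathcal A)$ if $U=\mathrm{CNOT}^c_t$, $Z_t(\mathcal A)$ if $U=\mathrm{CZ}^c_t$, and $\mathrm{CNOT}^{c'}_t(\mathcal A)$ (constructed recursively by this very construction) if $U=\mathrm{Toffoli}^{c,c'}_t$; in all cases $Q\subseteq Q_1$. Let $\mathcal A_1'=\langle Q_1',\Sigma_1,\Delta_1',\mathcal R'\rangle$ be a copy of $\mathcal A_1$ on a set $Q_1'=\{q'\mid q\in Q_1\}$ of fresh states disjoint from $Q$. Let $U(\mathcal A)$ be the TA with states $Q\cup Q_1'$, root states $\mathcal R$, and transitions $\Delta^R\cup\Delta_1'$, where \[\Delta^R=\{q\xrightarrow{x_k}(q_0,q_1)\in\Delta\mid k\ne c\}\cup\{q\xrightarrow{x_c}(q_0,q_1')\mid q\xrightarrow{x_c}(q_0,q_1)\in\Delta\}\cup\{\text{all leaf transitions of }\Delta\}.\] Then $\mathcal L(U(\mathcal A))=\{U(T)\mid T\in\mathcal L(\mathcal A)\}$.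
   Context: Tree automata: a TA is $\mathcal A=\langle Q,\Sigma,\Delta,\mathcal R\rangle$ with finite state set $Q$, ranked alphabet $\Sigma$ of binary and constant symbols, root states $\mathcal R\subseteq Q$, and transitions that are internal $q\xrightarrow{f}(q_0,q_1)$ or leaf $q\xrightarrow{c}()$. It is assumed that no state has leaf transitions with two different constants. A run on a binary tree labels each node with a state so that each leaf labelled $c$ with state $q$ has $q\xrightarrow{c}()\in\Delta$ and each internal node labelled $f$ with state $q$ and children states $q_0$ (left), $q_1$ (right) has $q\xrightarrow{f}(q_0,q_1)\in\Delta$; accepting if the root state is in $\mathcal R$; $\mathcal L(\mathcal A)$ is the set of trees with an accepting run. Encoding: amplitudes are tuples $(a,b,c,d,k)\in\mathbb Z^5$ representing $(1/\sqrt2)^k(a+b\omega+c\omega^2+d\omega^3)$, $\omega=e^{i\pi/4}$; for a scalar $a$, $a\cdot c$ denotes the tuple representing the product (e.g. $-1\cdot(a,b,c,d,k)=(-a,-b,-c,-d,k)$). An $n$-qubit tree is a full binary tree of height $n$ whose internal nodes at depth $j-1$ are labelled $x_j$ and whose leaves are labelled in $\mathbb Z^5$; $T(b)$ for $b\in\{0,1\}^n$ is the leaf reached by going at depth $j-1$ left if $b_j=0$ and right if $b_j=1$; $T$ represents $\sum_bT(b)|b\rangle$. $X_t(\mathcal A)$ is obtained from $\mathcal A$ by replacing each $q\xrightarrow{x_t}(q_0,q_1)$ by $q\xrightarrow{x_t}(q_1,q_0)$. $Z_t(\mathcal A)$ is the TA with states $Q\cup Q'$ ($Q'=\{q'\mid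 q\in Q\}$ disjoint), root states $\mathcal R$, and transitions $q'\xrightarrow{x_k}(q_0',q_1')$ and $q\xrightarrow{x_k}(q_0,q_1)$ for $q\xrightarrow{x_k}(q_0,q_1)\in\Delta$, $k\neq t$; $q'\xrightarrow{x_t}(q_0',q_1')$ and $q\xrightarrow{x_t}(q_0,q_1')$ for $q\xrightarrow{x_t}(q_0,q_1)\in\Delta$; $q\xrightarrow{c}()$ and $q'\xrightarrow{-1\cdot c}()$ for $q\xrightarrow{c}()\in\Delta$. Gate semantics ($b[t:=v]$ replaces bit $t$ of $b$ by $v$): $X_t(T)(b)=T(b[t:=1-b_t])$, $Z_t(T)(b)=(-1)^{b_t}T(b)$; $\mathrm{CNOT}^c_t(T)(b)=T(b)$ if $b_c=0$ and $X_t(T)(b)$ if $b_c=1$; $\mathrm{CZ}^c_t(T)(b)=T(b)$ if $b_c=0$ and $Z_t(T)(b)$ if $b_c=1$; $\mathrm{Toffoli}^{c,c'}_t(T)(b)=X_t(T)(b)$ if $b_c=b_{c'}=1$ and $T(b)$ otherwise. *)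

theory Defs
  imports Complex_Main
begin

section \<open>Amplitudes\<close>

type_synonym amp = "int \<times> int \<times> int \<times> int \<times> int"

definition amp_val :: "amp \<Rightarrow> complex" where
  "amp_val = (\<lambda>(a, b, c, d, k). let \<omega> = cis (pi / 4) in
     complex_of_real ((1 / sqrt 2) powi k) *
       (of_int a + of_int b * \<omega> + of_int c * \<omega>^2 + of_int d * \<omega>^3))"

definition amp_scale :: "int \<Rightarrow> amp \<Rightarrow> amp" where
  "amp_scale s = (\<lambda>(a, b, c, d, k). (s * a, s * b, s * c, s * d, k))"

lemma amp_val_scale: "amp_val (amp_scale s c) = of_int s * amp_val c"
  by (cases c) (simp add: amp_val_def amp_scale_def Let_def algebra_simps)

lemma amp_scale_minus_one: "amp_scale (-1) (a, b, c, d, k) = (-a, -b, -c, -d, k)"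
  by (simp add: amp_scale_def)


section \<open>Trees and tree automata\<close>

datatype ('f, 'c) btree = Leaf 'c | Node 'f "('f, 'c) btree" "('f, 'c) btree"

record ('q, 'f, 'c) ta =
  states :: "'q set"
  bin_syms :: "'f set"
  const_syms :: "'c set"
  int_trans :: "('q \<times> 'f \<times> 'q \<times> 'q) set"
  leaf_trans :: "('q \<times> 'c) set"
  roots :: "'q set"

definition is_ta :: "('q, 'f, 'c) ta \<Rightarrow> bool" where
  "is_ta A \<longleftrightarrow>
     finite (states A) \<and>
     roots A \<subseteq> states A \<and>
     int_trans A \<subseteq> states A \<times> bin_syms A \<times> states A \<times> states A \<and>
     leaf_trans A \<subseteq> states A \<times> const_syms A \<and>
     (\<forall>q c d. (q, c) \<in> leaf_trans A \<and> (q, d) \<in> leaf_trans A \<longrightarrow> c = d)"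

fun root_label :: "('q, 'q) btree \<Rightarrow> 'q" where
  "root_label (Leaf q) = q"
| "root_label (Node q _ _) = q"

text \<open>A labelling of the nodes of a tree with states is a tree of the same shape
  all of whose nodes carry states.\<close>

fun is_run :: "('q, 'f, 'c) ta \<Rightarrow> ('f, 'c) btree \<Rightarrow> ('q, 'q) btree \<Rightarrow> bool" where
  "is_run A (Leaf c) (Leaf q) \<longleftrightarrow> (q, c) \<in> leaf_trans A"
| "is_run A (Node f l r) (Node q \<rho>\<^sub>0 \<rho>\<^sub>1) \<longleftrightarrow>
     (q, f, root_label \<rho>\<^sub>0, root_label \<rho>\<^sub>1) \<in> int_trans A \<and> is_run A l \<rho>\<^sub>0 \<and> is_run A r \<rho>\<^sub>1"
| "is_run A (Leaf _) (Node _ _ _) \<longleftrightarrow> False"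
| "is_run A (Node _ _ _) (Leaf _) \<longleftrightarrow> False"

definition lang :: "('q, 'f, 'c) ta \<Rightarrow> ('f, 'c) btree set" where
  "lang A = {T. \<exists>\<rho>. is_run A T \<rho> \<and> root_label \<rho> \<in> roots A}"


section \<open>Qubit trees\<close>

text \<open>The binary symbol \<open>x\<^sub>j\<close> is represented by its index \<open>j\<close>.
  Bit strings are lists, \<open>True\<close> being 1 (right); qubits are numbered from 1,
  so bit \<open>j\<close> of \<open>b\<close> is \<open>b ! (j - 1)\<close>.\<close>

type_synonym qtree = "(nat, amp) btree"
type_synonym 'q qta = "('q, nat, amp) ta"

abbreviation qbit :: "bool list \<Rightarrow> nat \<Rightarrow> bool" where
  "qbit b j \<equiv> b ! (j - 1)"

text \<open>\<open>full_from j m T\<close>: the tree \<open>T\<close> is full of height \<open>m\<close>, with levels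
  labelled \<open>x\<^sub>j, x\<^sub>j\<^sub>+\<^sub>1, \<dots>\<close> from the root downwards.\<close>

fun full_from :: "nat \<Rightarrow> nat \<Rightarrow> qtree \<Rightarrow> bool" where
  "full_from j 0 (Leaf _) \<longleftrightarrow> True"
| "full_from j (Suc m) (Node k l r) \<longleftrightarrow>
     k = j \<and> full_from (Suc j) m l \<and> full_from (Suc j) m r"
| "full_from j 0 (Node _ _ _) \<longleftrightarrow> False"
| "full_from j (Suc m) (Leaf _) \<longleftrightarrow> False"

definition qubit_tree :: "nat \<Rightarrow> qtree \<Rightarrow> bool" where
  "qubit_tree n T \<longleftrightarrow> full_from 1 n T"

fun leaf_at :: "qtree \<Rightarrow> bool list \<Rightarrow> amp" where
  "leaf_at (Leaf c) _ = c"
| "leaf_at (Node _ l r) (v # b) = leaf_at (if v then r else l) b"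
| "leaf_at (Node _ _ _) [] = undefined"

fun build_from :: "nat \<Rightarrow> nat \<Rightarrow> (bool list \<Rightarrow> amp) \<Rightarrow> qtree" where
  "build_from j 0 \<phi> = Leaf (\<phi> [])"
| "build_from j (Suc m) \<phi> =
     Node j (build_from (Suc j) m (\<lambda>b. \<phi> (False # b))) (build_from (Suc j) m (\<lambda>b. \<phi> (True # b)))"

text \<open>The unique \<open>n\<close>-qubit tree whose leaf at \<open>b\<close> is \<open>\<phi> b\<close>; cf. the lemmas
  \<open>qubit_tree_qtree_of\<close>, \<open>leaf_at_qtree_of\<close> and \<open>qubit_tree_eqI\<close> below.\<close>

definition qtree_of :: "nat \<Rightarrow> (bool list \<Rightarrow> amp) \<Rightarrow> qtree" where
  "qtree_of n \<phi> = build_from 1 n \<phi>"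

lemma full_from_build: "full_from j m (build_from j m \<phi>)"
  by (induction m arbitrary: j \<phi>) auto

lemma leaf_at_build: "length b = m \<Longrightarrow> leaf_at (build_from j m \<phi>) b = \<phi> b"
proof (induction m arbitrary: j \<phi> b)
  case (Suc m)
  then show ?case by (cases b) auto
qed simp

lemma full_from_eqI:
  assumes "full_from j m S" "full_from j m T"
    and "\<And>b. length b = m \<Longrightarrow> leaf_at S b = leaf_at T b"
  shows "S = T"
  using assms
proof (induction j m S arbitrary: T rule: full_from.induct)
  case (1 j c)
  then show ?case by (cases T) auto
next
  case (2 j m k l r)
  then obtain l' r' where T: "T = Node j l' r'" "full_from (Suc j) m l'" "full_from (Suc j) m r'"
    by (cases T) auto
  have "l = l'"
    using "2.prems"(1) T "2.prems"(3)[of "False # _"] by (intro "2.IH"(1)) auto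
  moreover have "r = r'"
    using "2.prems"(1) T "2.prems"(3)[of "True # _"] by (intro "2.IH"(2)) auto
  ultimately show ?case using T "2.prems"(1) by simp
qed auto

lemma qubit_tree_qtree_of: "qubit_tree n (qtree_of n \<phi>)"
  by (simp add: qubit_tree_def qtree_of_def full_from_build)

lemma leaf_at_qtree_of: "length b = n \<Longrightarrow> leaf_at (qtree_of n \<phi>) b = \<phi> b"
  by (simp add: qtree_of_def leaf_at_build)

lemma qubit_tree_eqI:
  assumes "qubit_tree n S" "qubit_tree n T"
    and "\<And>b. length b = n \<Longrightarrow> leaf_at S b = leaf_at T b"
  shows "S = T"
  using assms full_from_eqI unfolding qubit_tree_def by blast


section \<open>Gate semantics\<close>

datatype gate = CNOT nat nat | CZ nat nat | Toffoli nat nat nat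

text \<open>Controls come first, the target is the last argument.\<close>

fun valid_gate :: "nat \<Rightarrow> gate \<Rightarrow> bool" where
  "valid_gate n (CNOT c t) \<longleftrightarrow> 1 \<le> c \<and> c < t \<and> t \<le> n"
| "valid_gate n (CZ c t) \<longleftrightarrow> 1 \<le> c \<and> c < t \<and> t \<le> n"
| "valid_gate n (Toffoli c c' t) \<longleftrightarrow> 1 \<le> c \<and> c < c' \<and> c' < t \<and> t \<le> n"

definition X_sem :: "nat \<Rightarrow> (bool list \<Rightarrow> amp) \<Rightarrow> bool list \<Rightarrow> amp" where
  "X_sem t \<phi> b = \<phi> (b[t - 1 := \<not> qbit b t])"

definition Z_sem :: "nat \<Rightarrow> (bool list \<Rightarrow> amp) \<Rightarrow> bool list \<Rightarrow> amp" where
  "Z_sem t \<phi> b = amp_scale ((-1) ^ of_bool (qbit b t)) (\<phi> b)"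

fun gate_sem :: "gate \<Rightarrow> (bool list \<Rightarrow> amp) \<Rightarrow> bool list \<Rightarrow> amp" where
  "gate_sem (CNOT c t) \<phi> b = (if qbit b c then X_sem t \<phi> b else \<phi> b)"
| "gate_sem (CZ c t) \<phi> b = (if qbit b c then Z_sem t \<phi> b else \<phi> b)"
| "gate_sem (Toffoli c c' t) \<phi> b = (if qbit b c \<and> qbit b c' then X_sem t \<phi> b else \<phi> b)"

definition apply_gate :: "nat \<Rightarrow> gate \<Rightarrow> qtree \<Rightarrow> qtree" where
  "apply_gate n U T = qtree_of n (gate_sem U (leaf_at T))"


section \<open>Gate constructions on automata\<close>

text \<open>Primed copies of states are given by a map \<open>p\<close> (\<open>q' = p q\<close>) that is injective on the
  copied states \<open>S\<close> and whose values avoid \<open>Q\<close>; all results are for an arbitrary such choice.\<close>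

definition fresh_copy :: "('q \<Rightarrow> 'q) \<Rightarrow> 'q set \<Rightarrow> 'q set \<Rightarrow> bool" where
  "fresh_copy p S Q \<longleftrightarrow> inj_on p S \<and> p ` S \<inter> Q = {}"

definition rename_ta :: "('q \<Rightarrow> 'q) \<Rightarrow> 'q qta \<Rightarrow> 'q qta" where
  "rename_ta p A = \<lparr>
     states = p ` states A,
     bin_syms = bin_syms A,
     const_syms = const_syms A,
     int_trans = {(p q, k, p q\<^sub>0, p q\<^sub>1) | q k q\<^sub>0 q\<^sub>1. (q, k, q\<^sub>0, q\<^sub>1) \<in> int_trans A},
     leaf_trans = {(p q, c) | q c. (q, c) \<in> leaf_trans A},
     roots = p ` roots A\<rparr>"

definition X_ta :: "nat \<Rightarrow> 'q qta \<Rightarrow> 'q qta" where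
  "X_ta t A = A\<lparr>int_trans :=
     {(q, k, q\<^sub>0, q\<^sub>1) | q k q\<^sub>0 q\<^sub>1. (q, k, q\<^sub>0, q\<^sub>1) \<in> int_trans A \<and> k \<noteq> t} \<union>
     {(q, t, q\<^sub>1, q\<^sub>0) | q q\<^sub>0 q\<^sub>1. (q, t, q\<^sub>0, q\<^sub>1) \<in> int_trans A}\<rparr>"

definition Z_ta :: "nat \<Rightarrow> ('q \<Rightarrow> 'q) \<Rightarrow> 'q qta \<Rightarrow> 'q qta" where
  "Z_ta t p A = \<lparr>
     states = states A \<union> p ` states A,
     bin_syms = bin_syms A,
     const_syms = const_syms A \<union> amp_scale (-1) ` const_syms A,
     int_trans =
       {(p q, k, p q\<^sub>0, p q\<^sub>1) | q k q\<^sub>0 q\<^sub>1. (q, k, q\<^sub>0, q\<^sub>1) \<in> int_trans A \<and> k \<noteq> t} \<union>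
       {(q, k, q\<^sub>0, q\<^sub>1) | q k q\<^sub>0 q\<^sub>1. (q, k, q\<^sub>0, q\<^sub>1) \<in> int_trans A \<and> k \<noteq> t} \<union>
       {(p q, t, p q\<^sub>0, p q\<^sub>1) | q q\<^sub>0 q\<^sub>1. (q, t, q\<^sub>0, q\<^sub>1) \<in> int_trans A} \<union>
       {(q, t, q\<^sub>0, p q\<^sub>1) | q q\<^sub>0 q\<^sub>1. (q, t, q\<^sub>0, q\<^sub>1) \<in> int_trans A},
     leaf_trans =
       leaf_trans A \<union> {(p q, amp_scale (-1) c) | q c. (q, c) \<in> leaf_trans A},
     roots = roots A\<rparr>"

text \<open>The controlled construction from \<open>A\<close>, \<open>A\<^sub>1\<close> and the copy of \<open>A\<^sub>1\<close> along \<open>p\<close>.\<close>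

definition ctrl_ta :: "nat \<Rightarrow> ('q \<Rightarrow> 'q) \<Rightarrow> 'q qta \<Rightarrow> 'q qta \<Rightarrow> 'q qta" where
  "ctrl_ta c p A A\<^sub>1 = (let A\<^sub>1' = rename_ta p A\<^sub>1 in \<lparr>
     states = states A \<union> states A\<^sub>1',
     bin_syms = bin_syms A \<union> bin_syms A\<^sub>1',
     const_syms = const_syms A \<union> const_syms A\<^sub>1',
     int_trans =
       {(q, k, q\<^sub>0, q\<^sub>1) | q k q\<^sub>0 q\<^sub>1. (q, k, q\<^sub>0, q\<^sub>1) \<in> int_trans A \<and> k \<noteq> c} \<union>
       {(q, c, q\<^sub>0, p q\<^sub>1) | q q\<^sub>0 q\<^sub>1. (q, c, q\<^sub>0, q\<^sub>1) \<in> int_trans A} \<union>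
       int_trans A\<^sub>1',
     leaf_trans = leaf_trans A \<union> leaf_trans A\<^sub>1',
     roots = roots A\<rparr>)"

text \<open>\<open>gate_ta U A B\<close>: the automaton \<open>B\<close> is \<open>U(A)\<close>, for some choice of the fresh states.\<close>

inductive gate_ta :: "gate \<Rightarrow> 'q qta \<Rightarrow> 'q qta \<Rightarrow> bool" where
  CNOT: "\<lbrakk>A\<^sub>1 = X_ta t A; fresh_copy p (states A\<^sub>1) (states A)\<rbrakk>
     \<Longrightarrow> gate_ta (CNOT c t) A (ctrl_ta c p A A\<^sub>1)"
| CZ: "\<lbrakk>fresh_copy z (states A) (states A); A\<^sub>1 = Z_ta t z A;
      fresh_copy p (states A\<^sub>1) (states A)\<rbrakk>
     \<Longrightarrow> gate_ta (CZ c t) A (ctrl_ta c p A A\<^sub>1)"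
| Toffoli: "\<lbrakk>gate_ta (CNOT c' t) A A\<^sub>1; fresh_copy p (states A\<^sub>1) (states A)\<rbrakk>
     \<Longrightarrow> gate_ta (Toffoli c c' t) A (ctrl_ta c p A A\<^sub>1)"

lemma ex_fresh_copy:
  assumes "infinite (UNIV :: 'q set)" "finite S" "finite Q"
  shows "\<exists>p :: 'q \<Rightarrow> 'q. fresh_copy p S Q"
proof -
  have "infinite (- Q)" using assms(1,3) by (metis Compl_eq_Diff_UNIV Diff_infinite_finite)
  then obtain S' where S': "finite S'" "card S' = card S" "S' \<subseteq> - Q"
    using infinite_arbitrarily_large by blast
  then obtain p where "bij_betw p S S'" using finite_same_card_bij assms(2) by metis
  with S' show ?thesis unfolding fresh_copy_def bij_betw_def by blast
qed

text \<open>Over an infinite type of states the construction is always possible.\<close>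

lemma ex_gate_ta:
  fixes A :: "'q qta"
  assumes inf: "infinite (UNIV :: 'q set)" and fin: "finite (states A)"
  shows "\<exists>B. gate_ta U A B"
proof -
  note ex = ex_fresh_copy[OF inf]
  have cnot: "\<exists>B. gate_ta (CNOT c t) A B \<and> finite (states B)" for c t
  proof -
    have fin1: "finite (states (X_ta t A))" using fin by (simp add: X_ta_def)
    obtain p where "fresh_copy p (states (X_ta t A)) (states A)" using ex[OF fin1 fin] by blast
    then have "gate_ta (CNOT c t) A (ctrl_ta c p A (X_ta t A))" by (rule gate_ta.CNOT[OF refl])
    moreover have "finite (states (ctrl_ta c p A (X_ta t A)))"
      using fin fin1 by (simp add: ctrl_ta_def rename_ta_def Let_def)
    ultimately show ?thesis by blast
  qed
  show ?thesis
  proof (cases U)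
    case (CNOT c t)
    then show ?thesis using cnot by blast
  next
    case (CZ c t)
    obtain z where z: "fresh_copy z (states A) (states A)" using ex[OF fin fin] by blast
    have "finite (states (Z_ta t z A))" using fin by (simp add: Z_ta_def)
    then obtain p where "fresh_copy p (states (Z_ta t z A)) (states A)" using ex fin by blast
    then show ?thesis using gate_ta.CZ[OF z refl] CZ by blast
  next
    case (Toffoli c c' t)
    then show ?thesis using cnot ex fin gate_ta.Toffoli by metis
  qed
qed

end

theory Submission imports Defs begin

text \<open>Each construction mirrors an operation on arbitrary labelled trees, defined by structural
  recursion: swapping the children at every \<open>x\<^sub>t\<close>, negating the leaves to the right of every
  \<open>x\<^sub>t\<close>, or applying a given operation to the right of every \<open>x\<^sub>c\<close>. All these operations are
  involutions, so the language of the new automaton at an original state is the preimage, and hence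
  the image, of the old one. No fullness of trees is needed for this; it only enters when
  the structural operations are compared with the gate semantics on full trees.\<close>

section \<open>Acceptance from a state\<close>

text \<open>Hiding the run in the successive choices of child states allows induction on the input
  tree with the state left arbitrary.\<close>

fun accepts :: "('q, 'f, 'c) ta \<Rightarrow> ('f, 'c) btree \<Rightarrow> 'q \<Rightarrow> bool" where
  "accepts A (Leaf c) q \<longleftrightarrow> (q, c) \<in> leaf_trans A"
| "accepts A (Node f l r) q \<longleftrightarrow>
     (\<exists>q\<^sub>0 q\<^sub>1. (q, f, q\<^sub>0, q\<^sub>1) \<in> int_trans A \<and> accepts A l q\<^sub>0 \<and> accepts A r q\<^sub>1)"

lemma accepts_iff_run: "accepts A T q \<longleftrightarrow> (\<exists>\<rho>. is_run A T \<rho> \<and> root_label \<rho> = q)"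
proof (induction T arbitrary: q)
  case (Leaf c)
  have "is_run A (Leaf c) \<rho> \<longleftrightarrow> (\<exists>s. \<rho> = Leaf s \<and> (s, c) \<in> leaf_trans A)" for \<rho>
    by (cases \<rho>) auto
  then show ?case by auto
next
  case (Node f l r)
  have "is_run A (Node f l r) \<rho> \<longleftrightarrow> (\<exists>s \<rho>\<^sub>0 \<rho>\<^sub>1. \<rho> = Node s \<rho>\<^sub>0 \<rho>\<^sub>1 \<and>
      (s, f, root_label \<rho>\<^sub>0, root_label \<rho>\<^sub>1) \<in> int_trans A \<and> is_run A l \<rho>\<^sub>0 \<and> is_run A r \<rho>\<^sub>1)" for \<rho>
    by (cases \<rho>) auto
  then show ?case by (fastforce simp: Node.IH)
qed

lemma lang_accepts: "lang A = {T. \<exists>q \<in> roots A. accepts A T q}"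
  by (auto simp: lang_def accepts_iff_run)

text \<open>The invariant that survives nested constructions: existing transitions involve only
  \<open>states A\<close>, so fresh states cannot clash with them.\<close>

definition trans_closed :: "('q, 'f, 'c) ta \<Rightarrow> bool" where
  "trans_closed A \<longleftrightarrow>
     int_trans A \<subseteq> states A \<times> UNIV \<times> states A \<times> states A \<and> leaf_trans A \<subseteq> states A \<times> UNIV"

lemma is_ta_trans_closed: "is_ta A \<Longrightarrow> trans_closed A"
  by (auto simp: is_ta_def trans_closed_def)

lemma trans_closedD:
  assumes "trans_closed A"
  shows "(q, k, q\<^sub>0, q\<^sub>1) \<in> int_trans A \<Longrightarrow> q \<in> states A \<and> q\<^sub>0 \<in> states A \<and> q\<^sub>1 \<in> states A"
    and "(q, c) \<in> leaf_trans A \<Longrightarrow> q \<in> states A"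
  using assms by (auto simp: trans_closed_def)

lemma fresh_copy_eq:
  assumes "fresh_copy p S Q" "x \<in> S" "y \<in> S"
  shows "p x = p y \<longleftrightarrow> x = y"
  using assms by (auto simp: fresh_copy_def inj_on_def)

lemma fresh_copy_neq:
  assumes "fresh_copy p S Q" "x \<in> S" "y \<in> Q"
  shows "p x \<noteq> y"
  using assms by (auto simp: fresh_copy_def)


section \<open>Structural operations on trees\<close>

fun swap_at :: "nat \<Rightarrow> (nat, 'c) btree \<Rightarrow> (nat, 'c) btree" where
  "swap_at t (Leaf c) = Leaf c"
| "swap_at t (Node k l r) =
     (if k = t then Node k (swap_at t r) (swap_at t l) else Node k (swap_at t l) (swap_at t r))"

fun neg_leaves :: "qtree \<Rightarrow> qtree" where
  "neg_leaves (Leaf c) = Leaf (amp_scale (-1) c)"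
| "neg_leaves (Node k l r) = Node k (neg_leaves l) (neg_leaves r)"

text \<open>Mirrors the transitions of the controlled automaton: the right child of
  \<open>x\<^sub>c\<close> enters the primed copy for good, so \<open>F\<close> takes over that
  whole subtree, while the left child stays among the original states.\<close>

fun ctrl_at :: "nat \<Rightarrow> ((nat, 'c) btree \<Rightarrow> (nat, 'c) btree) \<Rightarrow> (nat, 'c) btree \<Rightarrow> (nat, 'c) btree" where
  "ctrl_at c F (Leaf a) = Leaf a"
| "ctrl_at c F (Node k l r) = Node k (ctrl_at c F l) (if k = c then F r else ctrl_at c F r)"

text \<open>The operation performed by \<open>Z\<^sub>t\<close> is itself a controlled one, namely negation
  controlled by \<open>t\<close>.\<close>

fun gate_op :: "gate \<Rightarrow> qtree \<Rightarrow> qtree" where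
  "gate_op (CNOT c t) = ctrl_at c (swap_at t)"
| "gate_op (CZ c t) = ctrl_at c (ctrl_at t neg_leaves)"
| "gate_op (Toffoli c c' t) = ctrl_at c (ctrl_at c' (swap_at t))"

lemma swap_at_invol [simp]: "swap_at t (swap_at t T) = T"
  by (induction T) auto

lemma amp_scale_invol [simp]: "amp_scale (-1) (amp_scale (-1) c) = c"
  by (cases c) (simp add: amp_scale_def)

lemma amp_scale_one [simp]: "amp_scale 1 c = c"
  by (cases c) (simp add: amp_scale_def)

lemma neg_leaves_invol [simp]: "neg_leaves (neg_leaves T) = T"
  by (induction T) auto

lemma ctrl_at_invol:
  assumes "\<And>T. F (F T) = T"
  shows "ctrl_at c F (ctrl_at c F T) = T"
  using assms by (induction T) auto

lemma gate_op_invol: "gate_op U (gate_op U T) = T"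
  by (cases U) (simp_all add: ctrl_at_invol)


section \<open>Acceptance in the constructed automata\<close>

lemma accepts_X_ta: "accepts (X_ta t A) T q \<longleftrightarrow> accepts A (swap_at t T) q"
  by (induction T arbitrary: q) (auto simp: X_ta_def)

lemma trans_closed_X_ta: "trans_closed A \<Longrightarrow> trans_closed (X_ta t A)"
  by (auto simp: trans_closed_def X_ta_def)

lemma trans_closed_Z_ta: "trans_closed A \<Longrightarrow> trans_closed (Z_ta t z A)"
  by (auto simp: trans_closed_def Z_ta_def)

lemma trans_closed_ctrl_ta:
  assumes "trans_closed A" "trans_closed A\<^sub>1" "states A \<subseteq> states A\<^sub>1"
  shows "trans_closed (ctrl_ta c p A A\<^sub>1)"
proof -
  let ?C = "ctrl_ta c p A A\<^sub>1"
  have "q \<in> states ?C \<and> q\<^sub>0 \<in> states ?C \<and> q\<^sub>1 \<in> states ?C"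
    if "(q, k, q\<^sub>0, q\<^sub>1) \<in> int_trans ?C" for q k q\<^sub>0 q\<^sub>1
    using that assms(3) trans_closedD(1)[OF assms(1)] trans_closedD(1)[OF assms(2)]
    by (auto simp: ctrl_ta_def rename_ta_def Let_def; blast)
  moreover have "q \<in> states ?C" if "(q, a) \<in> leaf_trans ?C" for q a
    using that trans_closedD(2)[OF assms(1)] trans_closedD(2)[OF assms(2)]
    by (auto simp: ctrl_ta_def rename_ta_def Let_def; blast)
  ultimately show ?thesis unfolding trans_closed_def by fast
qed

section \<open>The phase flip \<open>Z_ta\<close>\<close>

context
  fixes A :: "'q qta" and z :: "'q \<Rightarrow> 'q" and t :: nat
  assumes closed: "trans_closed A" and fresh: "fresh_copy z (states A) (states A)"
begin

text \<open>Freshness excludes the original transitions at \<open>z q\<close>, and injectivity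
  recovers \<open>q\<close> from \<open>z q\<close>, so only the copied transitions of
  \<open>q\<close> remain.\<close>

lemma Z_ta_trans_copy:
  assumes "q \<in> states A"
  shows "(z q, k, a, b) \<in> int_trans (Z_ta t z A) \<longleftrightarrow>
      (\<exists>q\<^sub>0 q\<^sub>1. a = z q\<^sub>0 \<and> b = z q\<^sub>1 \<and> (q, k, q\<^sub>0, q\<^sub>1) \<in> int_trans A)"
    and "(z q, d) \<in> leaf_trans (Z_ta t z A) \<longleftrightarrow> (q, amp_scale (-1) d) \<in> leaf_trans A"
proof -
  have orig: "(z q, x) \<notin> leaf_trans A" "(z q, y) \<notin> int_trans A" for x y
    using fresh_copy_neq[OF fresh assms] trans_closedD[OF closed] by (metis prod_cases3)+
  have eq: "z q = z s \<longleftrightarrow> q = s" if "s \<in> states A" for s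
    using fresh_copy_eq[OF fresh assms that] .
  show "(z q, k, a, b) \<in> int_trans (Z_ta t z A) \<longleftrightarrow>
      (\<exists>q\<^sub>0 q\<^sub>1. a = z q\<^sub>0 \<and> b = z q\<^sub>1 \<and> (q, k, q\<^sub>0, q\<^sub>1) \<in> int_trans A)"
  proof
    show "\<exists>q\<^sub>0 q\<^sub>1. a = z q\<^sub>0 \<and> b = z q\<^sub>1 \<and> (q, k, q\<^sub>0, q\<^sub>1) \<in> int_trans A"
      if "(z q, k, a, b) \<in> int_trans (Z_ta t z A)"
      using that orig eq trans_closedD(1)[OF closed] by (auto simp: Z_ta_def; blast)
  qed (auto simp: Z_ta_def)
  show "(z q, d) \<in> leaf_trans (Z_ta t z A) \<longleftrightarrow> (q, amp_scale (-1) d) \<in> leaf_trans A"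
    using orig eq trans_closedD(2)[OF closed]
    \<comment> \<open>Involutivity turns \<open>d = amp_scale (-1) c\<close> into
      \<open>c = amp_scale (-1) d\<close>.\<close>
    by (simp add: Z_ta_def del: split_paired_Ex) (metis amp_scale_invol)
qed

lemma Z_ta_trans_orig:
  assumes "q \<in> states A"
  shows "(q, k, a, b) \<in> int_trans (Z_ta t z A) \<longleftrightarrow>
      (\<exists>q\<^sub>1. b = (if k = t then z q\<^sub>1 else q\<^sub>1) \<and> (q, k, a, q\<^sub>1) \<in> int_trans A)"
    and "(q, d) \<in> leaf_trans (Z_ta t z A) \<longleftrightarrow> (q, d) \<in> leaf_trans A"
proof -
  have neq: "q \<noteq> z s" if "s \<in> states A" for s
    using fresh_copy_neq[OF fresh that assms] by simp
  show "(q, k, a, b) \<in> int_trans (Z_ta t z A) \<longleftrightarrow>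
      (\<exists>q\<^sub>1. b = (if k = t then z q\<^sub>1 else q\<^sub>1) \<and> (q, k, a, q\<^sub>1) \<in> int_trans A)"
    using neq trans_closedD(1)[OF closed] by (auto simp: Z_ta_def; blast)
  show "(q, d) \<in> leaf_trans (Z_ta t z A) \<longleftrightarrow> (q, d) \<in> leaf_trans A"
    using neq trans_closedD(2)[OF closed] by (simp add: Z_ta_def del: split_paired_Ex) metis
qed

text \<open>Primed states only reach primed states, so a run started in the copy negates every leaf
  it reads.\<close>

lemma accepts_Z_ta_copy:
  "q \<in> states A \<Longrightarrow> accepts (Z_ta t z A) T (z q) \<longleftrightarrow> accepts A (neg_leaves T) q"
proof (induction T arbitrary: q)
  case (Node k l r)
  then show ?case
    using trans_closedD(1)[OF closed] by (simp add: Z_ta_trans_copy) blast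
qed (simp add: Z_ta_trans_copy)

text \<open>Only the right child of an \<open>x\<^sub>t\<close> node crosses into the copy, where
  \<open>accepts_Z_ta_copy\<close> settles the whole subtree.\<close>

lemma accepts_Z_ta:
  "q \<in> states A \<Longrightarrow> accepts (Z_ta t z A) T q \<longleftrightarrow> accepts A (ctrl_at t neg_leaves T) q"
proof (induction T arbitrary: q)
  case (Node k l r)
  then show ?case
    using trans_closedD(1)[OF closed] accepts_Z_ta_copy
    by (simp add: Z_ta_trans_orig) blast
qed (simp add: Z_ta_trans_orig)

end

section \<open>The controlled construction \<open>ctrl_ta\<close>\<close>

context
  fixes A A\<^sub>1 :: "'q qta" and p :: "'q \<Rightarrow> 'q" and c :: nat
  assumes closed: "trans_closed A" and closed1: "trans_closed A\<^sub>1"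
    and sub: "states A \<subseteq> states A\<^sub>1" and fresh: "fresh_copy p (states A\<^sub>1) (states A)"
begin

lemma ctrl_ta_trans_copy:
  assumes "q \<in> states A\<^sub>1"
  shows "(p q, k, a, b) \<in> int_trans (ctrl_ta c p A A\<^sub>1) \<longleftrightarrow>
      (\<exists>q\<^sub>0 q\<^sub>1. a = p q\<^sub>0 \<and> b = p q\<^sub>1 \<and> (q, k, q\<^sub>0, q\<^sub>1) \<in> int_trans A\<^sub>1)"
    and "(p q, d) \<in> leaf_trans (ctrl_ta c p A A\<^sub>1) \<longleftrightarrow> (q, d) \<in> leaf_trans A\<^sub>1"
proof -
  have orig: "(p q, x) \<notin> leaf_trans A" "(p q, y) \<notin> int_trans A" for x y
    using fresh_copy_neq[OF fresh assms] trans_closedD[OF closed] by (metis prod_cases3)+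
  have eq: "p q = p s \<longleftrightarrow> q = s" if "s \<in> states A\<^sub>1" for s
    using fresh_copy_eq[OF fresh assms that] .
  show "(p q, k, a, b) \<in> int_trans (ctrl_ta c p A A\<^sub>1) \<longleftrightarrow>
      (\<exists>q\<^sub>0 q\<^sub>1. a = p q\<^sub>0 \<and> b = p q\<^sub>1 \<and> (q, k, q\<^sub>0, q\<^sub>1) \<in> int_trans A\<^sub>1)"
  proof
    show "\<exists>q\<^sub>0 q\<^sub>1. a = p q\<^sub>0 \<and> b = p q\<^sub>1 \<and> (q, k, q\<^sub>0, q\<^sub>1) \<in> int_trans A\<^sub>1"
      if "(p q, k, a, b) \<in> int_trans (ctrl_ta c p A A\<^sub>1)"
      using that orig eq trans_closedD(1)[OF closed1]
      by (auto simp: ctrl_ta_def rename_ta_def Let_def; blast)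
  qed (auto simp: ctrl_ta_def rename_ta_def Let_def)
  show "(p q, d) \<in> leaf_trans (ctrl_ta c p A A\<^sub>1) \<longleftrightarrow> (q, d) \<in> leaf_trans A\<^sub>1"
    using orig eq trans_closedD(2)[OF closed1]
    by (simp add: ctrl_ta_def rename_ta_def Let_def del: split_paired_Ex) metis
qed

lemma ctrl_ta_trans_orig:
  assumes "q \<in> states A"
  shows "(q, k, a, b) \<in> int_trans (ctrl_ta c p A A\<^sub>1) \<longleftrightarrow>
      (\<exists>q\<^sub>1. b = (if k = c then p q\<^sub>1 else q\<^sub>1) \<and> (q, k, a, q\<^sub>1) \<in> int_trans A)"
    and "(q, d) \<in> leaf_trans (ctrl_ta c p A A\<^sub>1) \<longleftrightarrow> (q, d) \<in> leaf_trans A"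
proof -
  have neq: "q \<noteq> p s" if "s \<in> states A\<^sub>1" for s
    using fresh_copy_neq[OF fresh that assms] by simp
  show "(q, k, a, b) \<in> int_trans (ctrl_ta c p A A\<^sub>1) \<longleftrightarrow>
      (\<exists>q\<^sub>1. b = (if k = c then p q\<^sub>1 else q\<^sub>1) \<and> (q, k, a, q\<^sub>1) \<in> int_trans A)"
    using neq trans_closedD(1)[OF closed1] by (auto simp: ctrl_ta_def rename_ta_def Let_def; blast)
  show "(q, d) \<in> leaf_trans (ctrl_ta c p A A\<^sub>1) \<longleftrightarrow> (q, d) \<in> leaf_trans A"
    using neq trans_closedD(2)[OF closed1]
    by (simp add: ctrl_ta_def rename_ta_def Let_def del: split_paired_Ex) metis
qed

text \<open>The copy never returns to original states, so \<open>p\<close> transports the runs of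
  \<open>A\<^sub>1\<close> faithfully.\<close>

lemma accepts_ctrl_ta_copy:
  "q \<in> states A\<^sub>1 \<Longrightarrow> accepts (ctrl_ta c p A A\<^sub>1) T (p q) \<longleftrightarrow> accepts A\<^sub>1 T q"
proof (induction T arbitrary: q)
  case (Node k l r)
  then show ?case
    using trans_closedD(1)[OF closed1] by (simp add: ctrl_ta_trans_copy) blast
qed (simp add: ctrl_ta_trans_copy)

text \<open>Keeping \<open>F\<close> abstract serves all three gates, including Toffoli, whose
  \<open>A\<^sub>1\<close> is itself a controlled automaton.\<close>

lemma accepts_ctrl_ta:
  assumes F: "\<And>T q. q \<in> states A \<Longrightarrow> accepts A\<^sub>1 T q \<longleftrightarrow> accepts A (F T) q"
  shows "q \<in> states A \<Longrightarrow> accepts (ctrl_ta c p A A\<^sub>1) T q \<longleftrightarrow> accepts A (ctrl_at c F T) q"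
proof (induction T arbitrary: q)
  case (Node k l r)
  have "accepts (ctrl_ta c p A A\<^sub>1) r (p s) \<longleftrightarrow> accepts A (F r) s" if "s \<in> states A" for s
    using that sub accepts_ctrl_ta_copy F by blast
  then show ?case
    using Node trans_closedD(1)[OF closed] by (simp add: ctrl_ta_trans_orig) blast
qed (simp add: ctrl_ta_trans_orig)

end

section \<open>Gate automata and their languages\<close>

lemma accepts_gate_ta:
  assumes "gate_ta U A B" "trans_closed A"
  shows "trans_closed B \<and> states A \<subseteq> states B \<and> roots B = roots A \<and>
    (\<forall>T. \<forall>q \<in> states A. accepts B T q \<longleftrightarrow> accepts A (gate_op U T) q)"
  using assms
proof (induction rule: gate_ta.induct)
  case (CNOT A\<^sub>1 t A p c)
  have "states A \<subseteq> states A\<^sub>1" by (simp add: CNOT X_ta_def)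
  moreover have "trans_closed A\<^sub>1" by (simp add: CNOT trans_closed_X_ta)
  ultimately show ?case
    using CNOT accepts_ctrl_ta[of A A\<^sub>1 p "swap_at t"]
    by (simp add: trans_closed_ctrl_ta accepts_X_ta) (simp add: ctrl_ta_def Let_def)
next
  case (CZ z A A\<^sub>1 t p c)
  have "states A \<subseteq> states A\<^sub>1" by (simp add: CZ Z_ta_def)
  moreover have "trans_closed A\<^sub>1" by (simp add: CZ trans_closed_Z_ta)
  ultimately show ?case
    using CZ accepts_ctrl_ta[of A A\<^sub>1 p "ctrl_at t neg_leaves"]
    by (simp add: trans_closed_ctrl_ta accepts_Z_ta) (simp add: ctrl_ta_def Let_def)
next
  case (Toffoli c' t A A\<^sub>1 p c)
  then show ?case
    using accepts_ctrl_ta[of A A\<^sub>1 p "ctrl_at c' (swap_at t)"]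
    by (simp add: trans_closed_ctrl_ta) (simp add: ctrl_ta_def Let_def)
qed

lemma lang_gate_ta:
  assumes "is_ta A" "gate_ta U A B"
  shows "lang B = gate_op U ` lang A"
proof -
  have "roots A \<subseteq> states A" using assms(1) by (simp add: is_ta_def)
  then have "T \<in> lang B \<longleftrightarrow> gate_op U T \<in> lang A" for T
    using accepts_gate_ta[OF assms(2) is_ta_trans_closed[OF assms(1)]]
    by (auto simp: lang_accepts subset_iff)
  then show ?thesis by (metis (no_types, lifting) gate_op_invol image_iff subsetI subset_antisym)
qed


section \<open>Structural operations on full trees\<close>

lemma full_from_swap_at: "full_from j m T \<Longrightarrow> full_from j m (swap_at t T)"
  by (induction j m T rule: full_from.induct) auto

lemma full_from_neg_leaves: "full_from j m T \<Longrightarrow> full_from j m (neg_leaves T)"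
  by (induction j m T rule: full_from.induct) auto

text \<open>Fullness is assumed preserved at every starting level because \<open>F\<close> acts on
  subtrees rooted below \<open>x\<^sub>c\<close>.\<close>

lemma full_from_ctrl_at:
  assumes "\<And>j m T. full_from j m T \<Longrightarrow> full_from j m (F T)"
  shows "full_from j m T \<Longrightarrow> full_from j m (ctrl_at c F T)"
  using assms by (induction j m T rule: full_from.induct) auto

text \<open>All labels of a full tree starting at level \<open>j\<close> are at least
  \<open>j\<close>, so no \<open>x\<^sub>t\<close> occurs.\<close>

lemma swap_at_above: "full_from j m T \<Longrightarrow> t < j \<Longrightarrow> swap_at t T = T"
  by (induction j m T rule: full_from.induct) auto

lemma ctrl_at_above: "full_from j m T \<Longrightarrow> c < j \<Longrightarrow> ctrl_at c F T = T"
  by (induction j m T rule: full_from.induct) auto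

lemma leaf_at_neg_leaves:
  "full_from j m T \<Longrightarrow> length b = m \<Longrightarrow> leaf_at (neg_leaves T) b = amp_scale (-1) (leaf_at T b)"
proof (induction j m T arbitrary: b rule: full_from.induct)
  case (2 j m k l r)
  then show ?case by (cases b) auto
qed auto

text \<open>A subtree starting at level \<open>j\<close> sees only the bits from \<open>j\<close>
  on, so \<open>x\<^sub>t\<close> governs list position \<open>t - j\<close>; \<open>j = 1\<close>
  gives the index \<open>t - 1\<close> of \<open>X_sem\<close>.\<close>

lemma leaf_at_swap_at:
  assumes "full_from j m T" "length b = m" "j \<le> t" "t < j + m"
  shows "leaf_at (swap_at t T) b = leaf_at T (b[t - j := \<not> b ! (t - j)])"
  using assms
proof (induction j m T arbitrary: b rule: full_from.induct)
  case (2 j m k l r)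
  then obtain v b' where b: "b = v # b'" "length b' = m" by (cases b) auto
  show ?case
  proof (cases "t = j")
    case True
    \<comment> \<open>No further \<open>x\<^sub>t\<close> occurs below, so swapping merely exchanges
      the two subtrees.\<close>
    then show ?thesis using 2 b swap_at_above[of "Suc j" m _ t] by simp
  next
    case False
    \<comment> \<open>Passing to a child drops the head bit, which the index shift
      compensates.\<close>
    then have "t - j = Suc (t - Suc j)" using "2.prems" by simp
    then show ?thesis using 2 b False by simp
  qed
qed auto

text \<open>The assumption on \<open>F\<close> says that it commutes with all levels down to the control,
  so that applying it below \<open>x\<^sub>c\<close> amounts to applying it at the root.\<close>

lemma leaf_at_ctrl_at:
  assumes F: "\<And>k l r. k \<le> c \<Longrightarrow> F (Node k l r) = Node k (F l) (F r)"
    and "full_from j m T" "length b = m" "j \<le> c" "c < j + m"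
  shows "leaf_at (ctrl_at c F T) b = (if b ! (c - j) then leaf_at (F T) b else leaf_at T b)"
  using assms(2-)
proof (induction j m T arbitrary: b rule: full_from.induct)
  case (2 j m k l r)
  then obtain v b' where b: "b = v # b'" "length b' = m" by (cases b) auto
  show ?case
  proof (cases "c = j")
    case True
    \<comment> \<open>The left subtree contains no further \<open>x\<^sub>c\<close> and stays
      unchanged; on the right, \<open>F r\<close> is the right child of \<open>F\<close> applied to
      the whole node.\<close>
    then show ?thesis using 2 b F ctrl_at_above[of "Suc j" m l c F] by simp
  next
    case False
    then have "c - j = Suc (c - Suc j)" using "2.prems" by simp
    then show ?thesis using 2 b False F by simp
  qed
qed auto

lemma full_from_gate_op: "full_from j m T \<Longrightarrow> full_from j m (gate_op U T)"
  by (cases U) (simp_all add: full_from_ctrl_at full_from_swap_at full_from_neg_leaves)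

text \<open>Controls lie strictly above the target, and \<open>c\<close> above \<open>c'\<close>, so
  the operation under each control commutes with all levels down to it, as
  \<open>leaf_at_ctrl_at\<close> requires; \<open>neg_leaves\<close> commutes with every
  level.\<close>

lemma leaf_at_gate_op:
  assumes "full_from 1 n T" "length b = n" "valid_gate n U"
  shows "leaf_at (gate_op U T) b = gate_sem U (leaf_at T) b"
  using assms
  by (cases U) (auto simp: leaf_at_ctrl_at leaf_at_swap_at leaf_at_neg_leaves X_sem_def Z_sem_def)

lemma gate_op_eq_apply_gate:
  assumes "qubit_tree n T" "valid_gate n U"
  shows "gate_op U T = apply_gate n U T"
proof (rule qubit_tree_eqI)
  show "qubit_tree n (gate_op U T)"
    using assms(1) by (simp add: qubit_tree_def full_from_gate_op)
  show "qubit_tree n (apply_gate n U T)"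
    by (simp add: apply_gate_def qubit_tree_qtree_of)
  show "leaf_at (gate_op U T) b = leaf_at (apply_gate n U T) b" if "length b = n" for b
    using assms that by (simp add: apply_gate_def leaf_at_qtree_of leaf_at_gate_op qubit_tree_def)
qed

theorem theorem5p3:
  fixes A B :: "'q qta" and U :: gate and n :: nat
  assumes "is_ta A"
    and "\<forall>T \<in> lang A. qubit_tree n T"
    and "valid_gate n U"
    and "gate_ta U A B"
  shows "lang B = {apply_gate n U T | T. T \<in> lang A}"
proof -
  have "lang B = gate_op U ` lang A" using assms(1,4) by (rule lang_gate_ta)
  also have "\<dots> = apply_gate n U ` lang A"
    using assms(2,3) by (intro image_cong refl gate_op_eq_apply_gate) auto
  finally show ?thesis by (simp add: Setcompr_eq_image)
qed

end
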